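(* Let $\mu_f,\eta_p>0$, let $0<h<L$, and set $\underline{k}=\pi/L$ and $\overline{k}=\pi/h$. For $\alpha_f,\alpha_p>0$ and $k>0$ let $$\rho(\alpha_f,\alpha_p,k)=1-\alpha_p\,(1+2\,\mu_f\,\eta_p\,k^2)-\alpha_f\,\bigl(1+(2\,\mu_f\,\eta_p\,k^2)^{-1}\bigr).$$ Then the solution of the min-max problem $$\min_{\alpha_f,\alpha_p>0}\ \max_{k\in[\underline{k},\overline{k}]}|\rho(\alpha_f,\alpha_p,k)|$$ is given by $$\alpha_f^{NN}=\frac{(2\,\mu_f\,\eta_p\,\underline{k}\,\overline{k})^2}{1+(2\,\mu_f\,\eta_p\,\underline{k}\,\overline{k})^2+\mu_f\,\eta_p\,(\underline{k}+\overline{k})^2},\qquad \alpha_p^{NN}=\frac{1}{1+(2\,\mu_f\,\eta_p\,\underline{k}\,\overline{k})^2+\mu_f\,\eta_p\,(\underline{k}+\overline{k})^2}.$$ Moreover, $|\rho(\alpha_f^{NN},\alpha_p^{NN},k)|<1$ for all $k\in[\underline{k},\overline{k}]$, and, asymptotically, when $h\to0$ (with $L,\mu_f,\eta_p$ fixed), $$\alpha_f^{NN}=4\pi^2\mu_f\eta_p\,C_{NN}\,(1-2\,L\,C_{NN}\,h)+O(h^2),$$ $$\alpha_p^{NN}=L^2(\pi^2\mu_f\eta_p)^{-1}C_{NN}\,h^2+O(h^3),$$ $$\rho(\alpha_f^{NN},\alpha_p^{NN},\overline{k})=-L^2\,C_{NN}+(8\pi^2\mu_f\eta_pL+4L^3)\,C_{NN}^2\,h+O(h^2),$$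 where $C_{NN}=(4\pi^2\mu_f\,\eta_p+L^2)^{-1}$.
   Context: Here $\mu_f$ is the fluid viscosity, $\eta_p=\sqrt{\eta_1\eta_2}$ where $\mathrm{diag}(\eta_1,\eta_2)$ is the permeability tensor, $L$ is the length of the interface, $h$ is the mesh size, and $\underline{k}$, $\overline{k}$ are the minimum and maximum relevant frequencies. The function $|\rho(\alpha_f,\alpha_p,k)|$ is the reduction factor at frequency $k$ of the Neumann-Neumann method with weights $\alpha_f,\alpha_p$ for the Stokes-Darcy problem. *)

theory Defs
  imports "HOL-Analysis.Analysis" "HOL-Library.Landau_Symbols"
begin

definition rho :: "real \<Rightarrow> real \<Rightarrow> real \<Rightarrow> real \<Rightarrow> real \<Rightarrow> real" where
  "rho \<mu>f \<eta>p \<alpha>f \<alpha>p k =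
     1 - \<alpha>p * (1 + 2 * \<mu>f * \<eta>p * k\<^sup>2) - \<alpha>f * (1 + inverse (2 * \<mu>f * \<eta>p * k\<^sup>2))"

text \<open>The library's Max is restricted to finite sets, so the maximum over an interval of frequencies
  is written as a supremum; it is attained by continuity, as shown below.\<close>

definition max_abs_rho :: "real \<Rightarrow> real \<Rightarrow> real \<Rightarrow> real \<Rightarrow> real \<times> real \<Rightarrow> real" where
  "max_abs_rho \<mu>f \<eta>p kmin kmax = (\<lambda>(\<alpha>f, \<alpha>p). SUP k\<in>{kmin..kmax}. \<bar>rho \<mu>f \<eta>p \<alpha>f \<alpha>p k\<bar>)"

lemma max_abs_rho_attained:
  assumes "0 < \<mu>f" "0 < \<eta>p" "0 < kmin" "kmin \<le> kmax"
  obtains k where "k \<in> {kmin..kmax}"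
    and "max_abs_rho \<mu>f \<eta>p kmin kmax (\<alpha>f, \<alpha>p) = \<bar>rho \<mu>f \<eta>p \<alpha>f \<alpha>p k\<bar>"
    and "\<And>k'. k' \<in> {kmin..kmax} \<Longrightarrow> \<bar>rho \<mu>f \<eta>p \<alpha>f \<alpha>p k'\<bar> \<le> \<bar>rho \<mu>f \<eta>p \<alpha>f \<alpha>p k\<bar>"
proof -
  have "continuous_on {kmin..kmax} (\<lambda>k. \<bar>rho \<mu>f \<eta>p \<alpha>f \<alpha>p k\<bar>)"
    unfolding rho_def using assms by (intro continuous_intros) auto
  then obtain k where k: "k \<in> {kmin..kmax}"
      "\<And>k'. k' \<in> {kmin..kmax} \<Longrightarrow> \<bar>rho \<mu>f \<eta>p \<alpha>f \<alpha>p k'\<bar> \<le> \<bar>rho \<mu>f \<eta>p \<alpha>f \<alpha>p k\<bar>"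
    using continuous_attains_sup[of "{kmin..kmax}" "\<lambda>k. \<bar>rho \<mu>f \<eta>p \<alpha>f \<alpha>p k\<bar>"] assms by auto
  then have "(SUP k\<in>{kmin..kmax}. \<bar>rho \<mu>f \<eta>p \<alpha>f \<alpha>p k\<bar>) = \<bar>rho \<mu>f \<eta>p \<alpha>f \<alpha>p k\<bar>"
    by (intro cSup_eq_maximum) auto
  with k that show thesis by (simp add: max_abs_rho_def)
qed

definition alpha_f_NN :: "real \<Rightarrow> real \<Rightarrow> real \<Rightarrow> real \<Rightarrow> real" where
  "alpha_f_NN \<mu>f \<eta>p kmin kmax =
     (2 * \<mu>f * \<eta>p * kmin * kmax)\<^sup>2
       / (1 + (2 * \<mu>f * \<eta>p * kmin * kmax)\<^sup>2 + \<mu>f * \<eta>p * (kmin + kmax)\<^sup>2)"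

definition alpha_p_NN :: "real \<Rightarrow> real \<Rightarrow> real \<Rightarrow> real \<Rightarrow> real" where
  "alpha_p_NN \<mu>f \<eta>p kmin kmax =
     1 / (1 + (2 * \<mu>f * \<eta>p * kmin * kmax)\<^sup>2 + \<mu>f * \<eta>p * (kmin + kmax)\<^sup>2)"

definition C_NN :: "real \<Rightarrow> real \<Rightarrow> real \<Rightarrow> real" where
  "C_NN \<mu>f \<eta>p L = inverse (4 * pi\<^sup>2 * \<mu>f * \<eta>p + L\<^sup>2)"

end

theory Submission
  imports Defs
begin

text \<open>
  In the variable \<open>x = 2 \<mu>f \<eta>p k\<^sup>2\<close> the reduction factor is \<open>1 - (1 + x) (\<alpha>p + \<alpha>f / x)\<close>. On
  the range \<open>[a, b]\<close> of \<open>x\<close>, with geometric mean \<open>s = sqrt (a b)\<close>, the claimed weights make it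
  equioscillate: it equals \<open>- m\<close> at both ends and \<open>m\<close> at \<open>s\<close>, and stays within these values in
  between, because \<open>\<rho> + m\<close> and \<open>m - \<rho>\<close> are \<open>(b - x) (x - a)\<close> and \<open>(x - s)\<^sup>2\<close> up to the same
  positive factor (lemmas \<open>rho_NN_lower_gap\<close> and \<open>rho_NN_upper_gap\<close>).

  Equioscillation forces optimality and uniqueness at once. Subtract from the claimed reduction
  factor that of any other weights: up to the positive factor \<open>(1 + x) / x\<close> the difference is affine,
  \<open>u x + v\<close>. If the other weights achieve a maximum of at most \<open>m\<close>, this function is
  nonpositive at \<open>a\<close> and \<open>b\<close> but nonnegative at the interior point \<open>s\<close>, hence zero (lemma \<open>max_abs_rho_le_imp_NN\<close>).

  For the expansions, multiplying numerators and denominators by \<open>L\<^sup>2 h\<^sup>2\<close> turns the three quantities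
  into rational functions of \<open>h\<close> with one common denominator that does not vanish at \<open>0\<close>; each
  remainder is then exactly a power of \<open>h\<close> times a function continuous at \<open>0\<close>.
\<close>

section \<open>Equioscillation of the optimal reduction factor\<close>

abbreviation denom_NN :: "real \<Rightarrow> real \<Rightarrow> real \<Rightarrow> real \<Rightarrow> real" where
  "denom_NN \<mu>f \<eta>p kmin kmax \<equiv>
     1 + (2 * \<mu>f * \<eta>p * kmin * kmax)\<^sup>2 + \<mu>f * \<eta>p * (kmin + kmax)\<^sup>2"

text \<open>The common modulus \<open>m\<close> of the alternating extrema, and thus the value of the min-max
  problem.\<close>

definition m_NN :: "real \<Rightarrow> real \<Rightarrow> real \<Rightarrow> real \<Rightarrow> real" where
  "m_NN \<mu>f \<eta>p kmin kmax = \<mu>f * \<eta>p * (kmax - kmin)\<^sup>2 / denom_NN \<mu>f \<eta>p kmin kmax"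

lemma denom_NN_pos:
  assumes "0 < \<mu>f" "0 < \<eta>p"
  shows "0 < denom_NN \<mu>f \<eta>p kmin kmax"
  using assms by (intro add_pos_nonneg) auto

lemma rho_factored:
  assumes "0 < \<mu>f" "0 < \<eta>p" "0 < k"
  shows "rho \<mu>f \<eta>p \<alpha>f \<alpha>p k =
    1 - (1 + 2 * \<mu>f * \<eta>p * k\<^sup>2) / (2 * \<mu>f * \<eta>p * k\<^sup>2) * (\<alpha>p * (2 * \<mu>f * \<eta>p * k\<^sup>2) + \<alpha>f)"
  using assms unfolding rho_def by (simp add: field_simps)

lemma rho_NN:
  assumes "0 < \<mu>f" "0 < \<eta>p" "0 < k"
  shows "rho \<mu>f \<eta>p (alpha_f_NN \<mu>f \<eta>p kmin kmax) (alpha_p_NN \<mu>f \<eta>p kmin kmax) k =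
    1 - (1 + 2 * \<mu>f * \<eta>p * k\<^sup>2) * (2 * \<mu>f * \<eta>p * k\<^sup>2 + (2 * \<mu>f * \<eta>p * kmin * kmax)\<^sup>2)
          / (2 * \<mu>f * \<eta>p * k\<^sup>2 * denom_NN \<mu>f \<eta>p kmin kmax)"
  using assms denom_NN_pos[OF assms(1,2), of kmin kmax]
  unfolding rho_factored[OF assms] alpha_f_NN_def alpha_p_NN_def
  by (simp add: divide_simps)

lemma rho_NN_lower_gap:
  assumes "0 < \<mu>f" "0 < \<eta>p" "0 < k"
  shows "rho \<mu>f \<eta>p (alpha_f_NN \<mu>f \<eta>p kmin kmax) (alpha_p_NN \<mu>f \<eta>p kmin kmax) k
           + m_NN \<mu>f \<eta>p kmin kmax =
    2 * \<mu>f * \<eta>p * (kmax\<^sup>2 - k\<^sup>2) * (k\<^sup>2 - kmin\<^sup>2) / (k\<^sup>2 * denom_NN \<mu>f \<eta>p kmin kmax)"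
proof -
  define D where "D = denom_NN \<mu>f \<eta>p kmin kmax"
  have "0 < D" using denom_NN_pos[OF assms(1,2)] by (simp add: D_def)
  then have "rho \<mu>f \<eta>p (alpha_f_NN \<mu>f \<eta>p kmin kmax) (alpha_p_NN \<mu>f \<eta>p kmin kmax) k
           + m_NN \<mu>f \<eta>p kmin kmax =
    (2 * \<mu>f * \<eta>p * k\<^sup>2 * D
       - (1 + 2 * \<mu>f * \<eta>p * k\<^sup>2) * (2 * \<mu>f * \<eta>p * k\<^sup>2 + (2 * \<mu>f * \<eta>p * kmin * kmax)\<^sup>2)
       + 2 * \<mu>f * \<eta>p * k\<^sup>2 * (\<mu>f * \<eta>p * (kmax - kmin)\<^sup>2)) / (2 * \<mu>f * \<eta>p * k\<^sup>2 * D)"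
    using assms unfolding rho_NN[OF assms] m_NN_def D_def[symmetric]
    by (simp add: divide_simps)
  also have "\<dots> = 2 * \<mu>f * \<eta>p * (2 * \<mu>f * \<eta>p * (kmax\<^sup>2 - k\<^sup>2) * (k\<^sup>2 - kmin\<^sup>2))
                   / (2 * \<mu>f * \<eta>p * k\<^sup>2 * D)"
    unfolding D_def by (rule arg_cong[where f = "\<lambda>x. x / _"]) algebra
  also have "\<dots> = 2 * \<mu>f * \<eta>p * (kmax\<^sup>2 - k\<^sup>2) * (k\<^sup>2 - kmin\<^sup>2) / (k\<^sup>2 * D)"
    using assms by (simp add: ac_simps)
  finally show ?thesis by (simp only: D_def)
qed

lemma rho_NN_upper_gap:
  assumes "0 < \<mu>f" "0 < \<eta>p" "0 < k"
  shows "m_NN \<mu>f \<eta>p kmin kmax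
           - rho \<mu>f \<eta>p (alpha_f_NN \<mu>f \<eta>p kmin kmax) (alpha_p_NN \<mu>f \<eta>p kmin kmax) k =
    2 * \<mu>f * \<eta>p * (k\<^sup>2 - kmin * kmax)\<^sup>2 / (k\<^sup>2 * denom_NN \<mu>f \<eta>p kmin kmax)"
proof -
  define D where "D = denom_NN \<mu>f \<eta>p kmin kmax"
  have "0 < D" using denom_NN_pos[OF assms(1,2)] by (simp add: D_def)
  then have "m_NN \<mu>f \<eta>p kmin kmax
           - rho \<mu>f \<eta>p (alpha_f_NN \<mu>f \<eta>p kmin kmax) (alpha_p_NN \<mu>f \<eta>p kmin kmax) k =
    (2 * \<mu>f * \<eta>p * k\<^sup>2 * (\<mu>f * \<eta>p * (kmax - kmin)\<^sup>2)
       + (1 + 2 * \<mu>f * \<eta>p * k\<^sup>2) * (2 * \<mu>f * \<eta>p * k\<^sup>2 + (2 * \<mu>f * \<eta>p * kmin * kmax)\<^sup>2)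
       - 2 * \<mu>f * \<eta>p * k\<^sup>2 * D) / (2 * \<mu>f * \<eta>p * k\<^sup>2 * D)"
    using assms unfolding rho_NN[OF assms] m_NN_def D_def[symmetric]
    by (simp add: divide_simps)
  also have "\<dots> = 2 * \<mu>f * \<eta>p * (2 * \<mu>f * \<eta>p * (k\<^sup>2 - kmin * kmax)\<^sup>2)
                   / (2 * \<mu>f * \<eta>p * k\<^sup>2 * D)"
    unfolding D_def by (rule arg_cong[where f = "\<lambda>x. x / _"]) algebra
  also have "\<dots> = 2 * \<mu>f * \<eta>p * (k\<^sup>2 - kmin * kmax)\<^sup>2 / (k\<^sup>2 * D)"
    using assms by (simp add: ac_simps)
  finally show ?thesis by (simp only: D_def)
qed

lemma abs_rho_NN_le:
  assumes "0 < \<mu>f" "0 < \<eta>p" "0 < kmin" "k \<in> {kmin..kmax}"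
  shows "\<bar>rho \<mu>f \<eta>p (alpha_f_NN \<mu>f \<eta>p kmin kmax) (alpha_p_NN \<mu>f \<eta>p kmin kmax) k\<bar>
           \<le> m_NN \<mu>f \<eta>p kmin kmax"
proof -
  have k: "0 < k" "kmin\<^sup>2 \<le> k\<^sup>2" "k\<^sup>2 \<le> kmax\<^sup>2"
    using assms by (auto intro: power_mono)
  note D = denom_NN_pos[OF assms(1,2), of kmin kmax]
  have "0 \<le> 2 * \<mu>f * \<eta>p * (kmax\<^sup>2 - k\<^sup>2) * (k\<^sup>2 - kmin\<^sup>2) / (k\<^sup>2 * denom_NN \<mu>f \<eta>p kmin kmax)"
    using assms k D by (intro divide_nonneg_nonneg mult_nonneg_nonneg) auto
  moreover have "0 \<le> 2 * \<mu>f * \<eta>p * (k\<^sup>2 - kmin * kmax)\<^sup>2 / (k\<^sup>2 * denom_NN \<mu>f \<eta>p kmin kmax)"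
    using assms k D by (intro divide_nonneg_nonneg mult_nonneg_nonneg) auto
  ultimately show ?thesis
    using rho_NN_lower_gap[OF assms(1,2) k(1), of kmin kmax]
      rho_NN_upper_gap[OF assms(1,2) k(1), of kmin kmax] by linarith
qed

lemma m_NN_less_1:
  assumes "0 < \<mu>f" "0 < \<eta>p" "0 < kmin" "0 < kmax"
  shows "m_NN \<mu>f \<eta>p kmin kmax < 1"
proof -
  have "\<mu>f * \<eta>p * (kmax - kmin)\<^sup>2 \<le> \<mu>f * \<eta>p * (kmin + kmax)\<^sup>2"
    using assms by (intro mult_left_mono) (auto simp: power2_eq_square algebra_simps)
  then have "\<mu>f * \<eta>p * (kmax - kmin)\<^sup>2 < denom_NN \<mu>f \<eta>p kmin kmax"
    using zero_le_power2[of "2 * \<mu>f * \<eta>p * kmin * kmax"] by linarith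
  then show ?thesis
    using denom_NN_pos[OF assms(1,2), of kmin kmax] by (simp add: m_NN_def)
qed

section \<open>Optimality and uniqueness\<close>

lemma affine_zero_if_alternating:
  fixes u v a s b :: real
  assumes "a < s" "s < b" "u * a + v \<le> 0" "0 \<le> u * s + v" "u * b + v \<le> 0"
  shows "u = 0" "v = 0"
proof -
  have "0 \<le> u * (s - a)" "u * (b - s) \<le> 0"
    using assms by (simp_all add: algebra_simps)
  then show "u = 0"
    using assms by (smt (verit) mult_pos_pos mult_neg_pos)
  then show "v = 0" using assms by simp
qed

text \<open>A larger value of \<open>\<alpha>p x + \<alpha>f\<close> means a smaller reduction factor, so bounds on \<open>\<rho>\<close> at
  one frequency become sign conditions on the affine difference of the two sets of weights.\<close>

lemma rho_le_iff:
  assumes "0 < \<mu>f" "0 < \<eta>p" "0 < k"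
  shows "rho \<mu>f \<eta>p \<alpha>f \<alpha>p k \<le> rho \<mu>f \<eta>p \<beta>f \<beta>p k \<longleftrightarrow>
    0 \<le> (\<alpha>p - \<beta>p) * (2 * \<mu>f * \<eta>p * k\<^sup>2) + (\<alpha>f - \<beta>f)"
proof -
  define c where "c = (1 + 2 * \<mu>f * \<eta>p * k\<^sup>2) / (2 * \<mu>f * \<eta>p * k\<^sup>2)"
  have "0 < c"
    using assms unfolding c_def by (intro divide_pos_pos add_pos_pos) auto
  then have "rho \<mu>f \<eta>p \<alpha>f \<alpha>p k \<le> rho \<mu>f \<eta>p \<beta>f \<beta>p k \<longleftrightarrow>
      \<beta>p * (2 * \<mu>f * \<eta>p * k\<^sup>2) + \<beta>f \<le> \<alpha>p * (2 * \<mu>f * \<eta>p * k\<^sup>2) + \<alpha>f"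
    unfolding rho_factored[OF assms] c_def[symmetric] by (simp add: mult_le_cancel_left_pos)
  then show ?thesis by (simp only: left_diff_distrib) linarith
qed

text \<open>Alternation at the three frequencies \<open>kmin\<close>, \<open>sqrt (kmin * kmax)\<close> and \<open>kmax\<close> leaves no room
  for any other pair of weights.\<close>

lemma max_abs_rho_le_imp_NN:
  assumes pos: "0 < \<mu>f" "0 < \<eta>p" "0 < kmin" and "kmin < kmax"
    and le: "max_abs_rho \<mu>f \<eta>p kmin kmax (\<alpha>f, \<alpha>p) \<le> m_NN \<mu>f \<eta>p kmin kmax"
  shows "\<alpha>f = alpha_f_NN \<mu>f \<eta>p kmin kmax" "\<alpha>p = alpha_p_NN \<mu>f \<eta>p kmin kmax"
proof -
  let ?f = "alpha_f_NN \<mu>f \<eta>p kmin kmax" and ?p = "alpha_p_NN \<mu>f \<eta>p kmin kmax"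
  let ?u = "\<alpha>p - ?p" and ?v = "\<alpha>f - ?f" and ?x = "\<lambda>k. 2 * \<mu>f * \<eta>p * k\<^sup>2"
  define ks where "ks = sqrt (kmin * kmax)"
  have ks2: "ks\<^sup>2 = kmin * kmax" using assms by (simp add: ks_def)
  have ks: "kmin < ks" "ks < kmax"
    using assms unfolding ks_def
    by (auto intro!: real_less_rsqrt real_less_lsqrt simp: power2_eq_square)
  have bound: "\<bar>rho \<mu>f \<eta>p \<alpha>f \<alpha>p k\<bar> \<le> m_NN \<mu>f \<eta>p kmin kmax" if "k \<in> {kmin..kmax}" for k
    using max_abs_rho_attained[of \<mu>f \<eta>p kmin kmax \<alpha>f \<alpha>p] that assms
    by (smt (verit))
  have ends: "?u * ?x k + ?v \<le> 0" if "k = kmin \<or> k = kmax" for k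
  proof -
    have k: "0 < k" "k \<in> {kmin..kmax}" using that assms by auto
    have "rho \<mu>f \<eta>p ?f ?p k = - m_NN \<mu>f \<eta>p kmin kmax"
      using rho_NN_lower_gap[OF pos(1,2) k(1), of kmin kmax] that by auto
    then have "rho \<mu>f \<eta>p ?f ?p k \<le> rho \<mu>f \<eta>p \<alpha>f \<alpha>p k"
      using bound[OF k(2)] by linarith
    then show ?thesis
      unfolding rho_le_iff[OF pos(1,2) k(1)] by (simp add: algebra_simps)
  qed
  have "rho \<mu>f \<eta>p ?f ?p ks = m_NN \<mu>f \<eta>p kmin kmax"
    using rho_NN_upper_gap[OF pos(1,2), of ks kmin kmax] ks ks2 pos by simp
  then have "rho \<mu>f \<eta>p \<alpha>f \<alpha>p ks \<le> rho \<mu>f \<eta>p ?f ?p ks"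
    using bound[of ks] ks by auto
  then have middle: "0 \<le> ?u * ?x ks + ?v"
    using rho_le_iff[OF pos(1,2), of ks] ks pos by simp
  have "?x kmin < ?x ks" "?x ks < ?x kmax"
    using ks pos by (auto intro: power_strict_mono)
  from affine_zero_if_alternating[OF this ends middle ends]
  show "\<alpha>f = ?f" "\<alpha>p = ?p" by auto
qed

lemma max_abs_rho_NN_le:
  assumes "0 < \<mu>f" "0 < \<eta>p" "0 < kmin" "kmin \<le> kmax"
  shows "max_abs_rho \<mu>f \<eta>p kmin kmax
           (alpha_f_NN \<mu>f \<eta>p kmin kmax, alpha_p_NN \<mu>f \<eta>p kmin kmax) \<le> m_NN \<mu>f \<eta>p kmin kmax"
  using assms by (auto simp: max_abs_rho_def intro!: cSUP_least abs_rho_NN_le)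

lemma is_arg_min_max_abs_rho_iff:
  assumes "0 < \<mu>f" "0 < \<eta>p" "0 < kmin" "kmin < kmax"
  shows "is_arg_min (max_abs_rho \<mu>f \<eta>p kmin kmax) (\<lambda>(\<alpha>f, \<alpha>p). 0 < \<alpha>f \<and> 0 < \<alpha>p) p
    \<longleftrightarrow> p = (alpha_f_NN \<mu>f \<eta>p kmin kmax, alpha_p_NN \<mu>f \<eta>p kmin kmax)" (is "?min p \<longleftrightarrow> p = ?opt")
proof -
  let ?J = "max_abs_rho \<mu>f \<eta>p kmin kmax"
  have unique: "q = ?opt" if "?J q \<le> ?J ?opt" for q
    using max_abs_rho_le_imp_NN[OF assms, of "fst q" "snd q"] that
      max_abs_rho_NN_le[of \<mu>f \<eta>p kmin kmax] assms by (cases q) auto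
  have "0 < alpha_f_NN \<mu>f \<eta>p kmin kmax" "0 < alpha_p_NN \<mu>f \<eta>p kmin kmax"
    using assms denom_NN_pos[OF assms(1,2), of kmin kmax]
    by (auto simp: alpha_f_NN_def alpha_p_NN_def)
  then have feasible: "(\<lambda>(\<alpha>f, \<alpha>p). 0 < \<alpha>f \<and> 0 < \<alpha>p) ?opt" by simp
  show ?thesis
  proof
    assume "?min p"
    with feasible have "?J p \<le> ?J ?opt"
      unfolding is_arg_min_def using not_less by blast
    then show "p = ?opt" by (rule unique)
  next
    assume "p = ?opt"
    with feasible show "?min p"
      unfolding is_arg_min_def using unique by (metis less_imp_le less_irrefl)
  qed
qed

section \<open>Expansion for a small mesh size\<close>

text \<open>Up to the factor \<open>L\<^sup>2 h\<^sup>2\<close>, the denominator of the optimal weights for \<open>kmin = pi / L\<close>,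
  \<open>kmax = pi / h\<close> and \<open>N = pi\<^sup>2 \<mu>f \<eta>p\<close>. Clearing \<open>h\<close> removes the singularity at \<open>0\<close>.\<close>

definition mesh_denom :: "real \<Rightarrow> real \<Rightarrow> real \<Rightarrow> real" where
  "mesh_denom N L h = L\<^sup>2 * h\<^sup>2 + 4 * N\<^sup>2 + N * (L + h)\<^sup>2"

lemma mesh_denom_pos:
  assumes "0 < N"
  shows "0 < mesh_denom N L h"
  using assms unfolding mesh_denom_def by (intro add_pos_nonneg add_nonneg_pos) auto

lemma denom_NN_mesh:
  assumes "0 < L" "0 < h"
  shows "denom_NN \<mu>f \<eta>p (pi / L) (pi / h) = mesh_denom (pi\<^sup>2 * \<mu>f * \<eta>p) L h / (L\<^sup>2 * h\<^sup>2)"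
proof -
  have "mesh_denom (pi\<^sup>2 * \<mu>f * \<eta>p) L h = L\<^sup>2 * h\<^sup>2 * denom_NN \<mu>f \<eta>p (pi / L) (pi / h)"
    using assms by (simp add: mesh_denom_def field_simps power2_eq_square)
  then show ?thesis using assms by simp
qed

lemma alpha_f_NN_mesh:
  assumes "0 < L" "0 < h"
  shows "alpha_f_NN \<mu>f \<eta>p (pi / L) (pi / h) =
    4 * (pi\<^sup>2 * \<mu>f * \<eta>p)\<^sup>2 / mesh_denom (pi\<^sup>2 * \<mu>f * \<eta>p) L h"
  unfolding alpha_f_NN_def denom_NN_mesh[OF assms]
  using assms by (simp add: power2_eq_square)

lemma alpha_p_NN_mesh:
  assumes "0 < L" "0 < h"
  shows "alpha_p_NN \<mu>f \<eta>p (pi / L) (pi / h) = L\<^sup>2 * h\<^sup>2 / mesh_denom (pi\<^sup>2 * \<mu>f * \<eta>p) L h"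
  unfolding alpha_p_NN_def denom_NN_mesh[OF assms] using assms by simp

lemma rho_NN_kmax_mesh:
  assumes "0 < \<mu>f" "0 < \<eta>p" "0 < L" "0 < h"
  shows "rho \<mu>f \<eta>p (alpha_f_NN \<mu>f \<eta>p (pi / L) (pi / h)) (alpha_p_NN \<mu>f \<eta>p (pi / L) (pi / h))
           (pi / h) = - (pi\<^sup>2 * \<mu>f * \<eta>p) * (L - h)\<^sup>2 / mesh_denom (pi\<^sup>2 * \<mu>f * \<eta>p) L h"
proof -
  have "\<mu>f * \<eta>p * (pi / h - pi / L)\<^sup>2 * (L\<^sup>2 * h\<^sup>2) = (pi\<^sup>2 * \<mu>f * \<eta>p) * (L - h)\<^sup>2"
    using assms by (simp add: field_simps power2_eq_square)
  then have "m_NN \<mu>f \<eta>p (pi / L) (pi / h) =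
      (pi\<^sup>2 * \<mu>f * \<eta>p) * (L - h)\<^sup>2 / mesh_denom (pi\<^sup>2 * \<mu>f * \<eta>p) L h"
    unfolding m_NN_def denom_NN_mesh[OF assms(3,4)] by simp
  then show ?thesis
    using rho_NN_lower_gap[OF assms(1,2), of "pi / h" "pi / L" "pi / h"] assms by simp
qed

lemma bigo_power_at_right_0:
  fixes f q :: "real \<Rightarrow> real"
  assumes "isCont q 0" and "\<And>h. 0 < h \<Longrightarrow> f h = h ^ n * q h"
  shows "f \<in> O[at_right 0](\<lambda>h. h ^ n)"
proof -
  have "(q \<longlongrightarrow> q 0) (at_right 0)"
    using assms(1) unfolding isCont_def by (rule filterlim_mono) (auto simp: at_le)
  then have "q \<in> O[at_right 0](\<lambda>_. 1)"
    by (intro bigoI_tendsto[of _ _ "q 0"]) auto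
  then have "(\<lambda>h. h ^ n * q h) \<in> O[at_right 0](\<lambda>h. h ^ n * 1)"
    by (intro landau_o.big.mult) auto
  moreover have "\<forall>\<^sub>F h in at_right 0. f h = h ^ n * q h"
    using assms(2) by (auto simp: eventually_at_filter)
  ultimately show ?thesis by (simp add: landau_o.big.in_cong)
qed

text \<open>From here on \<open>C\<close> stands for \<open>C_NN\<close>, through its defining relation. The common
  denominator equals \<open>N / C\<close> at \<open>h = 0\<close>; its product with \<open>C\<close> has the constant term \<open>N\<close>, against
  which the low powers of \<open>h\<close> in the three remainders cancel.\<close>

lemma mesh_denom_scaled:
  fixes N L C h :: real
  assumes C: "C * (4 * N + L\<^sup>2) = 1"
  shows "C * mesh_denom N L h = N + C * (2 * N * L * h + (L\<^sup>2 + N) * h\<^sup>2)"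
proof -
  have "C * mesh_denom N L h =
      N * (C * (4 * N + L\<^sup>2)) + C * (2 * N * L * h + (L\<^sup>2 + N) * h\<^sup>2)"
    unfolding mesh_denom_def by (simp add: power2_eq_square algebra_simps)
  with C show ?thesis by simp
qed

lemma alpha_f_remainder:
  fixes N L C h :: real
  assumes "0 < N" and C: "C * (4 * N + L\<^sup>2) = 1"
  shows "4 * N\<^sup>2 / mesh_denom N L h - 4 * N * C * (1 - 2 * L * C * h) =
    h ^ 2 * (- 4 * N * C * (L\<^sup>2 + N - 4 * N * L\<^sup>2 * C - 2 * L * C * (L\<^sup>2 + N) * h)
               / mesh_denom N L h)"
proof -
  have "4 * N\<^sup>2 - 4 * N * C * (1 - 2 * L * C * h) * mesh_denom N L h =
      4 * N\<^sup>2 - 4 * N * (1 - 2 * L * C * h) * (C * mesh_denom N L h)"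
    by simp
  also have "\<dots> = h ^ 2 * (- 4 * N * C * (L\<^sup>2 + N - 4 * N * L\<^sup>2 * C - 2 * L * C * (L\<^sup>2 + N) * h))"
    unfolding mesh_denom_scaled[OF C] by (simp add: power2_eq_square algebra_simps)
  finally have "4 * N\<^sup>2 - 4 * N * C * (1 - 2 * L * C * h) * mesh_denom N L h =
      h ^ 2 * (- 4 * N * C * (L\<^sup>2 + N - 4 * N * L\<^sup>2 * C - 2 * L * C * (L\<^sup>2 + N) * h))" .
  then show ?thesis
    using mesh_denom_pos[OF assms(1), of L h] by (simp add: field_simps)
qed

lemma alpha_p_remainder:
  fixes N L C h :: real
  assumes "0 < N" and C: "C * (4 * N + L\<^sup>2) = 1"
  shows "L\<^sup>2 * h\<^sup>2 / mesh_denom N L h - L\<^sup>2 * inverse N * C * h\<^sup>2 =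
    h ^ 3 * (- L\<^sup>2 * C * (2 * N * L + (L\<^sup>2 + N) * h) / (N * mesh_denom N L h))"
proof -
  have "N * (L\<^sup>2 * h\<^sup>2) - L\<^sup>2 * C * h\<^sup>2 * mesh_denom N L h =
      N * (L\<^sup>2 * h\<^sup>2) - L\<^sup>2 * h\<^sup>2 * (C * mesh_denom N L h)"
    by simp
  also have "\<dots> = h ^ 3 * (- L\<^sup>2 * C * (2 * N * L + (L\<^sup>2 + N) * h))"
    unfolding mesh_denom_scaled[OF C]
    by (simp add: power2_eq_square power3_eq_cube algebra_simps)
  finally have "N * (L\<^sup>2 * h\<^sup>2) - L\<^sup>2 * C * h\<^sup>2 * mesh_denom N L h =
      h ^ 3 * (- L\<^sup>2 * C * (2 * N * L + (L\<^sup>2 + N) * h))" .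
  then show ?thesis
    using mesh_denom_pos[OF assms(1), of L h] assms(1) by (simp add: field_simps)
qed

lemma rho_remainder:
  fixes N L C h :: real
  assumes "0 < N" and C: "C * (4 * N + L\<^sup>2) = 1"
  defines "K \<equiv> 8 * N * L + 4 * L ^ 3"
  shows "- N * (L - h)\<^sup>2 / mesh_denom N L h - (- L\<^sup>2 * C + K * C\<^sup>2 * h) =
    h ^ 2 * ((- N + L\<^sup>2 * C * (L\<^sup>2 + N) - 2 * N * L * K * C\<^sup>2 - K * C\<^sup>2 * (L\<^sup>2 + N) * h)
               / mesh_denom N L h)"
proof -
  \<comment> \<open>The slope \<open>K C\<^sup>2\<close> of the expansion is the one that removes the term linear in \<open>h\<close>.\<close>
  have "K * C = 2 * L * (C * (4 * N + L\<^sup>2)) + 2 * L ^ 3 * C"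
    by (simp add: K_def power2_eq_square power3_eq_cube algebra_simps)
  then have K: "2 * L + 2 * L ^ 3 * C - K * C = 0" using C by simp
  have "- N * (L - h)\<^sup>2 - (- L\<^sup>2 * C + K * C\<^sup>2 * h) * mesh_denom N L h =
      - N * (L - h)\<^sup>2 - (- L\<^sup>2 + K * C * h) * (C * mesh_denom N L h)"
    by (simp add: power2_eq_square algebra_simps)
  also have "\<dots> = N * h * (2 * L + 2 * L ^ 3 * C - K * C) +
      h ^ 2 * (- N + L\<^sup>2 * C * (L\<^sup>2 + N) - 2 * N * L * K * C\<^sup>2 - K * C\<^sup>2 * (L\<^sup>2 + N) * h)"
    unfolding mesh_denom_scaled[OF C]
    by (simp add: power2_eq_square power3_eq_cube algebra_simps)
  finally have "- N * (L - h)\<^sup>2 - (- L\<^sup>2 * C + K * C\<^sup>2 * h) * mesh_denom N L h =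
      h ^ 2 * (- N + L\<^sup>2 * C * (L\<^sup>2 + N) - 2 * N * L * K * C\<^sup>2 - K * C\<^sup>2 * (L\<^sup>2 + N) * h)"
    unfolding K by simp
  then show ?thesis
    using mesh_denom_pos[OF assms(1), of L h] by (simp add: field_simps)
qed

lemma isCont_mesh_denom [continuous_intros]: "isCont (mesh_denom N L) h"
  unfolding mesh_denom_def by (intro continuous_intros)

section \<open>The optimal weights and their asymptotics\<close>

theorem proposition1p1:
  fixes \<mu>f \<eta>p L :: real
  assumes "0 < \<mu>f" and "0 < \<eta>p" and "0 < L"
  shows
    "(\<forall>h. 0 < h \<and> h < L \<longrightarrow>
        (\<forall>p. is_arg_min (max_abs_rho \<mu>f \<eta>p (pi / L) (pi / h))
                (\<lambda>(\<alpha>f, \<alpha>p). 0 < \<alpha>f \<and> 0 < \<alpha>p) p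
             \<longleftrightarrow> p = (alpha_f_NN \<mu>f \<eta>p (pi / L) (pi / h), alpha_p_NN \<mu>f \<eta>p (pi / L) (pi / h)))
      \<and> (\<forall>k\<in>{pi / L..pi / h}.
           \<bar>rho \<mu>f \<eta>p (alpha_f_NN \<mu>f \<eta>p (pi / L) (pi / h))
                        (alpha_p_NN \<mu>f \<eta>p (pi / L) (pi / h)) k\<bar> < 1))
     \<and> (\<lambda>h. alpha_f_NN \<mu>f \<eta>p (pi / L) (pi / h)
            - 4 * pi\<^sup>2 * \<mu>f * \<eta>p * C_NN \<mu>f \<eta>p L * (1 - 2 * L * C_NN \<mu>f \<eta>p L * h))
         \<in> O[at_right 0](\<lambda>h. h ^ 2)
     \<and> (\<lambda>h. alpha_p_NN \<mu>f \<eta>p (pi / L) (pi / h)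
            - L\<^sup>2 * inverse (pi\<^sup>2 * \<mu>f * \<eta>p) * C_NN \<mu>f \<eta>p L * h\<^sup>2)
         \<in> O[at_right 0](\<lambda>h. h ^ 3)
     \<and> (\<lambda>h. rho \<mu>f \<eta>p (alpha_f_NN \<mu>f \<eta>p (pi / L) (pi / h))
                        (alpha_p_NN \<mu>f \<eta>p (pi / L) (pi / h)) (pi / h)
            - (- L\<^sup>2 * C_NN \<mu>f \<eta>p L
               + (8 * pi\<^sup>2 * \<mu>f * \<eta>p * L + 4 * L ^ 3) * (C_NN \<mu>f \<eta>p L)\<^sup>2 * h))
         \<in> O[at_right 0](\<lambda>h. h ^ 2)"
proof -
  define N where "N = pi\<^sup>2 * \<mu>f * \<eta>p"
  define C where "C = C_NN \<mu>f \<eta>p L"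
  have N: "0 < N" using assms by (simp add: N_def)
  have "C = inverse (4 * N + L\<^sup>2)" by (simp add: C_def C_NN_def N_def mult.assoc)
  moreover have "0 < 4 * N + L\<^sup>2" using N by (intro add_pos_nonneg) auto
  ultimately have C: "C * (4 * N + L\<^sup>2) = 1" by simp
  have D: "mesh_denom N L h \<noteq> 0" for h
    using mesh_denom_pos[OF N, of L h] by linarith
  show ?thesis
  proof (intro conjI allI impI ballI)
    fix h :: real and p :: "real \<times> real"
    assume h: "0 < h \<and> h < L"
    then have "0 < pi / L" "pi / L < pi / h"
      using assms by (auto simp: divide_strict_left_mono)
    then show "is_arg_min (max_abs_rho \<mu>f \<eta>p (pi / L) (pi / h)) (\<lambda>(\<alpha>f, \<alpha>p). 0 < \<alpha>f \<and> 0 < \<alpha>p) p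
        \<longleftrightarrow> p = (alpha_f_NN \<mu>f \<eta>p (pi / L) (pi / h), alpha_p_NN \<mu>f \<eta>p (pi / L) (pi / h))"
      by (rule is_arg_min_max_abs_rho_iff[OF assms(1,2)])
  next
    fix h k :: real
    assume h: "0 < h \<and> h < L" and k: "k \<in> {pi / L..pi / h}"
    then show "\<bar>rho \<mu>f \<eta>p (alpha_f_NN \<mu>f \<eta>p (pi / L) (pi / h))
                (alpha_p_NN \<mu>f \<eta>p (pi / L) (pi / h)) k\<bar> < 1"
      using abs_rho_NN_le[OF assms(1,2) _ k] m_NN_less_1[OF assms(1,2), of "pi / L" "pi / h"] assms
      by (simp add: order.strict_trans1)
  next
    show "(\<lambda>h. alpha_f_NN \<mu>f \<eta>p (pi / L) (pi / h)
            - 4 * pi\<^sup>2 * \<mu>f * \<eta>p * C_NN \<mu>f \<eta>p L * (1 - 2 * L * C_NN \<mu>f \<eta>p L * h))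
         \<in> O[at_right 0](\<lambda>h. h ^ 2)"
    proof (rule bigo_power_at_right_0)
      fix h :: real assume "0 < h"
      then show "alpha_f_NN \<mu>f \<eta>p (pi / L) (pi / h)
            - 4 * pi\<^sup>2 * \<mu>f * \<eta>p * C_NN \<mu>f \<eta>p L * (1 - 2 * L * C_NN \<mu>f \<eta>p L * h) =
          h ^ 2 * (- 4 * N * C * (L\<^sup>2 + N - 4 * N * L\<^sup>2 * C - 2 * L * C * (L\<^sup>2 + N) * h)
               / mesh_denom N L h)"
        using alpha_f_remainder[OF N C, of h] alpha_f_NN_mesh[OF assms(3), of h \<mu>f \<eta>p]
        by (simp add: N_def C_def mult.assoc)
    qed (intro continuous_intros D)
  next
    show "(\<lambda>h. alpha_p_NN \<mu>f \<eta>p (pi / L) (pi / h)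
            - L\<^sup>2 * inverse (pi\<^sup>2 * \<mu>f * \<eta>p) * C_NN \<mu>f \<eta>p L * h\<^sup>2)
         \<in> O[at_right 0](\<lambda>h. h ^ 3)"
    proof (rule bigo_power_at_right_0)
      fix h :: real assume "0 < h"
      then show "alpha_p_NN \<mu>f \<eta>p (pi / L) (pi / h)
            - L\<^sup>2 * inverse (pi\<^sup>2 * \<mu>f * \<eta>p) * C_NN \<mu>f \<eta>p L * h\<^sup>2 =
          h ^ 3 * (- L\<^sup>2 * C * (2 * N * L + (L\<^sup>2 + N) * h) / (N * mesh_denom N L h))"
        using alpha_p_remainder[OF N C, of h] alpha_p_NN_mesh[OF assms(3), of h \<mu>f \<eta>p]
        by (simp only: N_def C_def)
    qed (use N D in \<open>auto intro!: continuous_intros\<close>)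
  next
    show "(\<lambda>h. rho \<mu>f \<eta>p (alpha_f_NN \<mu>f \<eta>p (pi / L) (pi / h))
                        (alpha_p_NN \<mu>f \<eta>p (pi / L) (pi / h)) (pi / h)
            - (- L\<^sup>2 * C_NN \<mu>f \<eta>p L
               + (8 * pi\<^sup>2 * \<mu>f * \<eta>p * L + 4 * L ^ 3) * (C_NN \<mu>f \<eta>p L)\<^sup>2 * h))
         \<in> O[at_right 0](\<lambda>h. h ^ 2)"
    proof (rule bigo_power_at_right_0)
      fix h :: real assume "0 < h"
      then show "rho \<mu>f \<eta>p (alpha_f_NN \<mu>f \<eta>p (pi / L) (pi / h))
                        (alpha_p_NN \<mu>f \<eta>p (pi / L) (pi / h)) (pi / h)
            - (- L\<^sup>2 * C_NN \<mu>f \<eta>p L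
               + (8 * pi\<^sup>2 * \<mu>f * \<eta>p * L + 4 * L ^ 3) * (C_NN \<mu>f \<eta>p L)\<^sup>2 * h) =
          h ^ 2 * ((- N + L\<^sup>2 * C * (L\<^sup>2 + N) - 2 * N * L * (8 * N * L + 4 * L ^ 3) * C\<^sup>2
               - (8 * N * L + 4 * L ^ 3) * C\<^sup>2 * (L\<^sup>2 + N) * h) / mesh_denom N L h)"
        using rho_remainder[OF N C, of h] rho_NN_kmax_mesh[OF assms, of h]
        by (simp add: N_def C_def mult.assoc)
    qed (intro continuous_intros D)
  qed
qed

end
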